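(* Let $p$ be an odd prime, $s\ge 1$, and let $k_1,\dots,k_s>1$ be odd integers. Consider the equation $$x^2=p^{2a}k_1^{2t_1}\cdots k_s^{2t_s}y^2-p^{a+b}k_1^{t_1+r_1}\cdots k_s^{t_s+r_s}\delta+1,\qquad \delta\in\{-2,-4,2,4\},$$ in $x,y,a,b,t_1,\dots,t_s$ positive integers and $r_1,\dots,r_s$ nonnegative integers, with $y$ odd, subject to $t_i>r_i$ for $i=1,\dots,s$ and $a\ge b$. (i) If $\delta\in\{2,-2\}$, then the only solutions are: (A) if $p\mid y$: $x=p^{a+b}k_1^{t_1+r_1}\cdots k_s^{t_s+r_s}-\frac{\delta}{2}$, $y=p^bk_1^{r_1}\cdots k_s^{r_s}$; (B) if $\delta=2$ and $p^b=3^t+2=2\cdot 3^{-2t}k_1^{t_1+r_1}\cdots k_s^{t_s+r_s}-1$ for some odd positive integer $t$: $x=\frac12(p^b-1)\big((p^b-1)^2-3\big)$, $y=3^{-t}k_1^{r_1}\cdots k_s^{r_s}$, $a=b$; (C) if $\delta=-2$ and $p^b=3^t-2=2\cdot 3^{-2t}k_1^{t_1+r_1}\cdots k_s^{t_s+r_s}+1$ for some even positive integer $t$: $x=\frac12(p^b+1)\big((p^b+1)^2-3\big)$, $y=3^{-t}k_1^{r_1}\cdots k_s^{r_s}$, $a=b$. (ii) If $\delta\in\{4,-4\}$, the equation has no solutions. *)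

theory Defs
  imports Complex_Main "HOL-Computational_Algebra.Primes"
begin

text \<open>
  The bases \<open>k\<^sub>1, \<dots>, k\<^sub>s\<close> and the exponents \<open>t\<^sub>1, \<dots>, t\<^sub>s\<close>, \<open>r\<^sub>1, \<dots>, r\<^sub>s\<close> are functions on \<open>nat\<close> of
  which only the values on \<open>{1..s}\<close> matter.
\<close>

definition admissible ::
  "nat \<Rightarrow> nat \<Rightarrow> nat \<Rightarrow> nat \<Rightarrow> nat \<Rightarrow> (nat \<Rightarrow> nat) \<Rightarrow> (nat \<Rightarrow> nat) \<Rightarrow> bool" where
  "admissible s x y a b t r \<longleftrightarrow>
     x > 0 \<and> y > 0 \<and> a > 0 \<and> b > 0 \<and> odd y \<and> a \<ge> b \<and>
     (\<forall>i\<in>{1..s}. t i > 0 \<and> t i > r i)"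

text \<open>Stated over \<open>int\<close>, so that the subtraction is not truncated.\<close>

definition equation ::
  "nat \<Rightarrow> nat \<Rightarrow> (nat \<Rightarrow> nat) \<Rightarrow> int \<Rightarrow> nat \<Rightarrow> nat \<Rightarrow> nat \<Rightarrow> nat \<Rightarrow> (nat \<Rightarrow> nat) \<Rightarrow> (nat \<Rightarrow> nat) \<Rightarrow> bool" where
  "equation p s k \<delta> x y a b t r \<longleftrightarrow>
     (int x)\<^sup>2 = int (p ^ (2 * a) * (\<Prod>i=1..s. k i ^ (2 * t i)) * y\<^sup>2)
               - int (p ^ (a + b) * (\<Prod>i=1..s. k i ^ (t i + r i))) * \<delta> + 1"

text \<open>
  The three families of solutions. Their equations are read in \<open>real\<close>, because of the
  divisions and the negative powers of 3; since \<open>x\<close> and \<open>y\<close> are natural numbers, they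
  include the requirement that the right-hand sides are integers (e.g. that the power
  of 3 divides \<open>k\<^sub>1^r\<^sub>1 \<cdots> k\<^sub>s^r\<^sub>s\<close>).
\<close>

definition family_A ::
  "nat \<Rightarrow> nat \<Rightarrow> (nat \<Rightarrow> nat) \<Rightarrow> int \<Rightarrow> nat \<Rightarrow> nat \<Rightarrow> nat \<Rightarrow> nat \<Rightarrow> (nat \<Rightarrow> nat) \<Rightarrow> (nat \<Rightarrow> nat) \<Rightarrow> bool" where
  "family_A p s k \<delta> x y a b t r \<longleftrightarrow>
     p dvd y \<and>
     real x = real p ^ (a + b) * (\<Prod>i=1..s. real (k i) ^ (t i + r i)) - real_of_int \<delta> / 2 \<and>
     y = p ^ b * (\<Prod>i=1..s. k i ^ r i)"

definition family_B ::
  "nat \<Rightarrow> nat \<Rightarrow> (nat \<Rightarrow> nat) \<Rightarrow> int \<Rightarrow> nat \<Rightarrow> nat \<Rightarrow> nat \<Rightarrow> nat \<Rightarrow> (nat \<Rightarrow> nat) \<Rightarrow> (nat \<Rightarrow> nat) \<Rightarrow> bool" where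
  "family_B p s k \<delta> x y a b t r \<longleftrightarrow>
     \<delta> = 2 \<and>
     (\<exists>m::nat. odd m \<and> m > 0 \<and>
        real p ^ b = 3 ^ m + 2 \<and>
        real p ^ b = 2 * 3 powi (- 2 * int m) * (\<Prod>i=1..s. real (k i) ^ (t i + r i)) - 1 \<and>
        real x = 1 / 2 * (real p ^ b - 1) * ((real p ^ b - 1)\<^sup>2 - 3) \<and>
        real y = 3 powi (- int m) * (\<Prod>i=1..s. real (k i) ^ r i) \<and>
        a = b)"

definition family_C ::
  "nat \<Rightarrow> nat \<Rightarrow> (nat \<Rightarrow> nat) \<Rightarrow> int \<Rightarrow> nat \<Rightarrow> nat \<Rightarrow> nat \<Rightarrow> nat \<Rightarrow> (nat \<Rightarrow> nat) \<Rightarrow> (nat \<Rightarrow> nat) \<Rightarrow> bool" where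
  "family_C p s k \<delta> x y a b t r \<longleftrightarrow>
     \<delta> = -2 \<and>
     (\<exists>m::nat. even m \<and> m > 0 \<and>
        real p ^ b = 3 ^ m - 2 \<and>
        real p ^ b = 2 * 3 powi (- 2 * int m) * (\<Prod>i=1..s. real (k i) ^ (t i + r i)) + 1 \<and>
        real x = 1 / 2 * (real p ^ b + 1) * ((real p ^ b + 1)\<^sup>2 - 3) \<and>
        real y = 3 powi (- int m) * (\<Prod>i=1..s. real (k i) ^ r i) \<and>
        a = b)"

end

theory Submission
  imports Defs
begin

text \<open>
  Put \<open>R = \<Prod>k\<^sub>i^r\<^sub>i\<close>, \<open>M = \<Prod>k\<^sub>i^(t\<^sub>i - r\<^sub>i)\<close>, \<open>N = p^(a-b) M\<close>, \<open>B = p^b R\<close> and \<open>\<delta> = 2e\<close>. For \<open>e = 1\<close>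
  or \<open>e = -1\<close> the equation is the Pell equation \<open>x\<^sup>2 = 1 + D B\<^sup>2\<close> with \<open>D = N (N y\<^sup>2 - 2e)\<close>, whose
  fundamental solution is \<open>(N y\<^sup>2 - e, y)\<close>; so \<open>B\<close> is its \<open>n\<close>-th solution, and \<open>n\<close> is odd
  because \<open>B\<close> is. As \<open>t\<^sub>i > r\<^sub>i\<close>, every prime divisor of \<open>B\<close> other than \<open>p\<close> divides \<open>D\<close>. For a prime
  \<open>q = 2k + 1\<close> dividing \<open>n\<close>, the \<open>q\<close>-th Chebyshev value \<open>U\<^sub>q(X)\<close> at the solution \<open>X\<close> of index \<open>n/q\<close>
  divides \<open>B\<close> and splits into coprime factors \<open>(U\<^sub>k\<^sub>+\<^sub>1 + U\<^sub>k) (U\<^sub>k\<^sub>+\<^sub>1 - U\<^sub>k)\<close> greater than 1. Since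
  \<open>U\<^sub>q \<equiv> q\<close> modulo \<open>D\<close>, its prime divisors are among \<open>p\<close> and \<open>q\<close>, so one factor is a power of \<open>p\<close>
  and the other a power of \<open>q\<close>. If \<open>q > 3\<close>, then \<open>q\<^sup>2\<close> divides neither factor, which makes the second
  one equal to \<open>q\<close>: too small. Hence \<open>q = 3\<close> and \<open>2X \<plusminus> 1\<close> are a power of 3 and a power of \<open>p\<close>. A
  second prime factor of \<open>n\<close> would make \<open>p\<close> divide the solution of index \<open>n/q\<close>, hence \<open>p = 3\<close>, a
  contradiction. Thus \<open>n = 1\<close> (family A) or \<open>n = 3\<close> (families B and C). For
  \<open>\<delta> = 4\<close> or \<open>\<delta> = -4\<close> the right-hand side is 2 modulo 4.
\<close>

section \<open>Chebyshev polynomials of the second kind\<close>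

text \<open>Indices are shifted by one: \<open>cheb_U X n\<close> is the polynomial usually called \<open>U\<^sub>n\<^sub>-\<^sub>1(X)\<close>.\<close>

fun cheb_U :: "int \<Rightarrow> nat \<Rightarrow> int" where
  "cheb_U X 0 = 0"
| "cheb_U X (Suc 0) = 1"
| "cheb_U X (Suc (Suc n)) = 2 * X * cheb_U X (Suc n) - cheb_U X n"

text \<open>The form \<open>u^2 - 2 X u v + v^2\<close> is unchanged by the recurrence step from
  \<open>(u, v)\<close> to \<open>(2 X u - v, u)\<close>. Hence consecutive values are
  coprime.\<close>

lemma cheb_U_norm:
  "(cheb_U X (Suc n))\<^sup>2 - 2 * X * cheb_U X (Suc n) * cheb_U X n + (cheb_U X n)\<^sup>2 = 1"
  by (induction n) (simp_all add: power2_eq_square algebra_simps)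

lemma cheb_U_double:
  "cheb_U X (2 * n + 1) = (cheb_U X (Suc n))\<^sup>2 - (cheb_U X n)\<^sup>2 \<and>
   cheb_U X (2 * n + 2) = 2 * cheb_U X (Suc n) * (X * cheb_U X (Suc n) - cheb_U X n)"
proof (induction n)
  case (Suc n)
  have 1: "cheb_U X (2 * Suc n + 1) = 2 * X * cheb_U X (2 * n + 2) - cheb_U X (2 * n + 1)"
    by simp
  have 2: "cheb_U X (2 * Suc n + 2) = 2 * X * cheb_U X (2 * Suc n + 1) - cheb_U X (2 * n + 2)"
    by simp
  show ?case
    unfolding 2 unfolding 1 Suc[THEN conjunct1] Suc[THEN conjunct2] cheb_U.simps
    by (simp add: power2_eq_square algebra_simps)
qed simp

lemma cheb_U_odd_factor:
  "cheb_U X (2 * n + 1) = (cheb_U X (Suc n) + cheb_U X n) * (cheb_U X (Suc n) - cheb_U X n)"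
  using cheb_U_double[of X n] by (simp add: power2_eq_square algebra_simps)

text \<open>Modulo \<open>X^2 - 1\<close> the recurrence is solved by \<open>n\<close> at odd and by
  \<open>n X\<close> at even indices; each parity carries the other through the induction.\<close>

lemma cheb_U_dvd_odd:
  "X\<^sup>2 - 1 dvd cheb_U X (2 * n + 1) - (2 * int n + 1) \<and>
   X\<^sup>2 - 1 dvd cheb_U X (2 * n + 2) - (2 * int n + 2) * X"
proof (induction n)
  case (Suc n)
  define v where "v = cheb_U X (2 * n + 1)"
  define w where "w = cheb_U X (2 * n + 2)"
  obtain c d where c: "v = (2 * int n + 1) + (X\<^sup>2 - 1) * c"
    and d: "w = (2 * int n + 2) * X + (X\<^sup>2 - 1) * d"
    using Suc unfolding v_def[symmetric] w_def[symmetric] dvd_def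
    by (metis add.commute diff_add_cancel)
  have 1: "cheb_U X (2 * Suc n + 1) = 2 * X * w - v"
    by (simp add: v_def w_def)
  have 2: "cheb_U X (2 * Suc n + 2) = 2 * X * (2 * X * w - v) - w"
    by (simp add: v_def w_def)
  have "cheb_U X (2 * Suc n + 1) - (2 * int (Suc n) + 1) =
      (X\<^sup>2 - 1) * (2 * (2 * int n + 2) + 2 * X * d - c)"
    unfolding 1 c d by (simp add: power2_eq_square algebra_simps)
  moreover have "cheb_U X (2 * Suc n + 2) - (2 * int (Suc n) + 2) * X =
      (X\<^sup>2 - 1) * (4 * X * (2 * int n + 2) + 4 * X\<^sup>2 * d - 2 * X * c - d)"
    unfolding 2 c d by (simp add: power2_eq_square algebra_simps)
  ultimately show ?case by (metis dvd_triv_left)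
qed simp

text \<open>The outer minus sign stands for the exponent \<open>n - 1\<close>, which would be
  truncated at \<open>n = 0\<close>.\<close>

lemma cheb_U_minus: "cheb_U (- X) n = - ((- 1) ^ n * cheb_U X n)"
  by (induction X n rule: cheb_U.induct) (simp_all add: algebra_simps)

text \<open>The Taylor expansion at \<open>X = 1\<close>, cleared of denominators.\<close>

lemma cheb_U_taylor:
  "(X - 1)\<^sup>2 dvd 3 * cheb_U X n - 3 * int n - (X - 1) * (int n ^ 3 - int n)"
proof (induction X n rule: cheb_U.induct)
  case (3 X n)
  define h where "h = X - 1"
  obtain c d where
    c: "3 * cheb_U X (Suc n) - 3 * int (Suc n) - h * (int (Suc n) ^ 3 - int (Suc n)) = h\<^sup>2 * c"
    and d: "3 * cheb_U X n - 3 * int n - h * (int n ^ 3 - int n) = h\<^sup>2 * d"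
    using 3 unfolding h_def dvd_def by metis
  have c': "3 * cheb_U X (Suc n) = 3 * int (Suc n) + h * (int (Suc n) ^ 3 - int (Suc n)) + h\<^sup>2 * c"
    using c by linarith
  have d': "3 * cheb_U X n = 3 * int n + h * (int n ^ 3 - int n) + h\<^sup>2 * d"
    using d by linarith
  have "3 * cheb_U X (Suc (Suc n)) = 2 * (h + 1) * (3 * cheb_U X (Suc n)) - 3 * cheb_U X n"
    by (simp add: h_def algebra_simps)
  also have "\<dots> = 3 * int (Suc (Suc n)) + h * (int (Suc (Suc n)) ^ 3 - int (Suc (Suc n)))
      + h\<^sup>2 * (2 * (int (Suc n) ^ 3 - int (Suc n)) + 2 * (h + 1) * c - d)"
    unfolding c' d' by (simp add: power2_eq_square power3_eq_cube algebra_simps)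
  finally have "3 * cheb_U X (Suc (Suc n)) - 3 * int (Suc (Suc n))
      - h * (int (Suc (Suc n)) ^ 3 - int (Suc (Suc n)))
      = h\<^sup>2 * (2 * (int (Suc n) ^ 3 - int (Suc n)) + 2 * (h + 1) * c - d)"
    by linarith
  then show ?case unfolding h_def by (metis dvd_triv_left)
qed simp_all

text \<open>Since \<open>2 X\<close> is at least 4, the next difference is at least three times the
  present one plus \<open>2 * cheb_U X n\<close>.\<close>

lemma cheb_U_growth:
  assumes "X \<ge> 2"
  shows "0 \<le> cheb_U X n \<and> 3 ^ n \<le> cheb_U X (Suc n) - cheb_U X n"
proof (induction n)
  case (Suc n)
  have "4 * cheb_U X (Suc n) \<le> 2 * X * cheb_U X (Suc n)"
    using Suc assms by (intro mult_right_mono) (auto intro: order_trans[of 0 "3 ^ n"])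
  moreover have "(0::int) < 3 ^ n" by simp
  ultimately show ?case using Suc by (simp only: cheb_U.simps power_Suc) linarith
qed simp

text \<open>In the expansion at \<open>X = 1\<close> the constant terms \<open>k + 1\<close> and
  \<open>k\<close> add up to \<open>q\<close>, and the linear coefficients add up to a multiple of
  \<open>q\<close>. As \<open>q\<close> divides \<open>X - 1\<close>, three times the sum is
  \<open>3 q\<close> modulo \<open>q^2\<close>.\<close>

lemma cheb_U_sum_dvd:
  fixes q :: int
  assumes q: "prime q" "q > 3" "q = 2 * int k + 1" and "q dvd X - 1"
  shows "q dvd cheb_U X (Suc k) + cheb_U X k" "\<not> q\<^sup>2 dvd cheb_U X (Suc k) + cheb_U X k"
proof -
  define f where "f = cheb_U X (Suc k) + cheb_U X k"
  have q3: "\<not> q dvd 3" using q(2) zdvd_imp_le[of q 3] by auto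
  obtain h where h: "X - 1 = q * h" using assms(4) by blast
  have "q\<^sup>2 dvd (X - 1)\<^sup>2" unfolding h by (simp add: power_mult_distrib)
  then have "q\<^sup>2 dvd (3 * cheb_U X (Suc k) - 3 * int (Suc k) - (X - 1) * (int (Suc k) ^ 3 - int (Suc k)))
      + (3 * cheb_U X k - 3 * int k - (X - 1) * (int k ^ 3 - int k))"
    by (meson cheb_U_taylor dvd_add dvd_trans)
  also have "\<dots> = 3 * f - 3 * q - (X - 1) * (q * (int k * (int k + 1)))"
    unfolding q(3) f_def by (simp add: power3_eq_cube algebra_simps)
  also have "\<dots> = 3 * f - 3 * q - q\<^sup>2 * (h * int k * (int k + 1))"
    unfolding h by (simp add: power2_eq_square algebra_simps)
  finally have *: "q\<^sup>2 dvd 3 * f - 3 * q"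
    using dvd_diff_left_iff[of "q\<^sup>2" "q\<^sup>2 * (h * int k * (int k + 1))" "3 * f - 3 * q"] by simp
  then have "q dvd 3 * f - 3 * q" by (metis dvd_mult_left power2_eq_square)
  then have "q dvd 3 * f" using dvd_diff_left_iff[of q "3 * q" "3 * f"] by simp
  then show "q dvd cheb_U X (Suc k) + cheb_U X k"
    using q3 q(1) prime_dvd_mult_iff unfolding f_def by blast
  show "\<not> q\<^sup>2 dvd cheb_U X (Suc k) + cheb_U X k"
  proof
    assume "q\<^sup>2 dvd cheb_U X (Suc k) + cheb_U X k"
    then have "q\<^sup>2 dvd 3 * f" unfolding f_def by (rule dvd_mult)
    with * have "q\<^sup>2 dvd 3 * q" using dvd_diff_right_iff by blast
    then show False using q3 q(2) by (simp add: power2_eq_square)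
  qed
qed

text \<open>Replacing \<open>X\<close> by \<open>- X\<close> turns the difference into the sum, up
  to sign.\<close>

lemma cheb_U_diff_dvd:
  fixes q :: int
  assumes q: "prime q" "q > 3" "q = 2 * int k + 1" and "q dvd X + 1"
  shows "q dvd cheb_U X (Suc k) - cheb_U X k" "\<not> q\<^sup>2 dvd cheb_U X (Suc k) - cheb_U X k"
proof -
  have "q dvd - X - 1" using assms(4) dvd_minus_iff[of q "X + 1"] by simp
  note S = cheb_U_sum_dvd[OF q this]
  have E: "cheb_U (- X) (Suc k) + cheb_U (- X) k = (- 1) ^ k * (cheb_U X (Suc k) - cheb_U X k)"
    by (simp add: cheb_U_minus algebra_simps)
  have U: "(- 1 :: int) ^ k dvd 1" by (metis dvd_triv_left left_minus_one_mult_self)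
  show "q dvd cheb_U X (Suc k) - cheb_U X k"
    using S(1) dvd_mult_unit_iff'[OF U] unfolding E by blast
  show "\<not> q\<^sup>2 dvd cheb_U X (Suc k) - cheb_U X k"
    using S(2) unfolding E by (metis dvd_mult)
qed

section \<open>Prime divisors of the two factors at an odd prime index\<close>

lemma int_eq_prime_power:
  fixes q n :: int
  assumes "n > 1" "prime q" "\<And>r. prime r \<Longrightarrow> r dvd n \<Longrightarrow> r = q"
  shows "\<exists>j>0. n = q ^ j"
proof -
  obtain m where m: "n = q ^ multiplicity q n * m" "\<not> q dvd m"
    using multiplicity_decompose'[of n q] assms(1,2) not_prime_unit[of q] by auto
  have q0: "q ^ multiplicity q n > 0" using assms(2) prime_gt_0_int by simp
  have "m > 0" using m(1) assms(1) q0
    by (metis less_trans zero_less_one zero_less_mult_pos)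
  have "m = 1"
  proof (rule ccontr)
    assume "m \<noteq> 1"
    with \<open>m > 0\<close> obtain r where "prime r" "r dvd m" using prime_divisor_exists[of m] by auto
    moreover from this have "r dvd n" by (subst m(1)) (rule dvd_mult)
    ultimately show False using assms(3) m(2) by blast
  qed
  then have "n = q ^ multiplicity q n" using m(1) by simp
  moreover from this have "multiplicity q n > 0" using assms(1)
    by (cases "multiplicity q n") auto
  ultimately show ?thesis by blast
qed

text \<open>Both factors exceed 1 and are coprime, while only the primes \<open>p\<close> and
  \<open>q\<close> are available, so each prime belongs to exactly one factor. \<open>B\<close> may
  be a proper multiple of the Chebyshev value, which lets the lemma act inside a larger
  solution.\<close>

lemma cheb_U_prime_index:
  fixes p q X D B :: int
  assumes X: "X \<ge> 2" and D: "D dvd X\<^sup>2 - 1"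
    and q: "prime q" "q = 2 * int k + 1"
    and B: "cheb_U X (2 * k + 1) dvd B" "odd B"
    and primes: "\<And>r. prime r \<Longrightarrow> r dvd B \<Longrightarrow> r dvd D \<or> r = p"
  shows "k = 1 \<and> p \<noteq> 3 \<and> prime p \<and> \<not> p dvd D \<and> 3 dvd B \<and> (\<exists>i j. i > 0 \<and> j > 0 \<and>
    (2 * X + 1 = 3 ^ j \<and> 2 * X - 1 = p ^ i \<or> 2 * X - 1 = 3 ^ j \<and> 2 * X + 1 = p ^ i))"
proof -
  define f where "f = cheb_U X (Suc k) + cheb_U X k"
  define g where "g = cheb_U X (Suc k) - cheb_U X k"
  have k: "k > 0" using q prime_gt_1_int[of q] by simp
  have U: "cheb_U X (2 * k + 1) = f * g"
    unfolding f_def g_def by (rule cheb_U_odd_factor)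
  have fg: "f dvd B" "g dvd B" using B(1) U by (metis dvd_mult_left dvd_mult_right)+
  have grow: "3 ^ k \<le> g" "g \<le> f" using cheb_U_growth[OF X, of k] by (auto simp: f_def g_def)
  have "(3::int) ^ 1 \<le> 3 ^ k" using k by (intro power_increasing) auto
  with grow have gt1: "f > 1" "g > 1" by auto
  \<comment> \<open>As \<open>B\<close> is odd, a common prime divisor of the factors would divide
    two consecutive Chebyshev values.\<close>
  have coprime: False if r: "prime r" "r dvd f" "r dvd g" for r
  proof -
    have "odd r" using r(2) fg B(2) by (meson dvd_trans)
    then have r2: "\<not> r dvd 2" using primes_dvd_imp_eq[OF r(1), of 2] by auto
    have "r dvd f + g" "r dvd f - g" using r by auto
    then have "r dvd 2 * cheb_U X (Suc k)" "r dvd 2 * cheb_U X k"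
      by (auto simp: f_def g_def)
    then have "r dvd cheb_U X (Suc k)" "r dvd cheb_U X k"
      using r2 r(1) prime_dvd_mult_iff by blast+
    then have "r dvd (cheb_U X (Suc k))\<^sup>2 - 2 * X * cheb_U X (Suc k) * cheb_U X k + (cheb_U X k)\<^sup>2"
      by (simp add: power2_eq_square)
    then show False using r(1) unfolding cheb_U_norm by auto
  qed
  \<comment> \<open>Modulo \<open>D\<close> the product \<open>f * g\<close> is congruent to its
    index \<open>q\<close>.\<close>
  have eq_q: "r = q" if r: "prime r" "r dvd f * g" "r dvd D" for r
  proof -
    have "r dvd cheb_U X (2 * k + 1) - (2 * int k + 1)"
      using cheb_U_dvd_odd[of X k] D r(3) by (meson dvd_trans)
    then have "r dvd q" using r(2) U q(2) dvd_diff_right_iff by metis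
    then show ?thesis using r(1) q(1) by (metis primes_dvd_imp_eq)
  qed
  have pq: "r = q \<or> r = p" if r: "prime r" "r dvd f * g" for r
    using primes[OF r(1)] eq_q[OF r] r(2) B(1) U by (metis dvd_trans)
  obtain u where u: "prime u" "u dvd f" using prime_divisor_exists[of f] gt1(1) by auto
  obtain v where v: "prime v" "v dvd g" using prime_divisor_exists[of g] gt1(2) by auto
  have uv: "u \<noteq> v" using coprime u v by blast
  have sets: "u = q \<and> v = p \<or> u = p \<and> v = q"
    using pq[of u] pq[of v] u v uv by auto
  have "\<exists>i>0. f = u ^ i"
  proof (rule int_eq_prime_power[OF gt1(1) u(1)])
    fix r assume r: "prime r" "r dvd f"
    then have "r \<noteq> v" using coprime v by blast
    then show "r = u" using pq[of r] r sets by auto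
  qed
  then obtain i where i: "i > 0" "f = u ^ i" by blast
  have "\<exists>j>0. g = v ^ j"
  proof (rule int_eq_prime_power[OF gt1(2) v(1)])
    fix r assume r: "prime r" "r dvd g"
    then have "r \<noteq> u" using coprime u by blast
    then show "r = v" using pq[of r] r sets by auto
  qed
  then obtain j where j: "j > 0" "g = v ^ j" by blast
  have pp: "prime p" and pne: "p \<noteq> q" using sets u v uv by auto
  have "p dvd f * g" "q dvd f * g" using sets u v by auto
  then have qB: "q dvd B" using B(1) U by (metis dvd_trans)
  have pD: "\<not> p dvd D" using eq_q[OF pp \<open>p dvd f * g\<close>] pne by auto
  have qD: "q dvd D" using primes[OF q(1) qB] pne by auto
  have "q dvd (X - 1) * (X + 1)" using qD D by (auto simp: power2_eq_square algebra_simps intro: dvd_trans)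
  then have q1: "q dvd X - 1 \<or> q dvd X + 1" using q(1) prime_dvd_mult_iff by blast
  have "q \<le> 3"
  proof (rule ccontr)
    assume "\<not> q \<le> 3"
    then have q3: "q > 3" by simp
    then have k2: "k \<ge> 2" using q(2) by simp
    \<comment> \<open>This makes even the smaller factor \<open>g\<close> larger than
      \<open>q\<close>.\<close>
    have "2 * int n + 1 < 3 ^ n" if "n \<ge> 2" for n
      using that by (induction n rule: dec_induct) auto
    from this[OF k2] have gq: "q < g" using q(2) grow(1) by simp
    \<comment> \<open>A prime power that \<open>q\<close> divides exactly once can only be
      \<open>q\<close> itself.\<close>
    have no: False if "w > q" "w = z ^ l" "prime z" "q dvd w" "\<not> q\<^sup>2 dvd w" for w z l
    proof -
      have "z = q" using that q(1) by (metis prime_dvd_power primes_dvd_imp_eq)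
      have "l < 2"
      proof (rule ccontr)
        assume "\<not> l < 2"
        then have "q\<^sup>2 dvd q ^ l" by (intro le_imp_power_dvd) auto
        then show False using that \<open>z = q\<close> by simp
      qed
      then have "l = 0 \<or> l = 1" by auto
      then show False using that \<open>z = q\<close> q3 by auto
    qed
    from q1 show False
    proof
      assume "q dvd X - 1"
      from cheb_U_sum_dvd[OF q(1) q3 q(2) this] show False
        using no[of f, OF _ i(2) u(1)] gq grow(2) by (simp add: f_def)
    next
      assume "q dvd X + 1"
      from cheb_U_diff_dvd[OF q(1) q3 q(2) this] show False
        using no[of g, OF _ j(2) v(1)] gq by (simp add: g_def)
    qed
  qed
  then have k1: "k = 1" using q(2) k by simp
  have q3: "q = 3" using q(2) k1 by simp
  have F: "f = 2 * X + 1" "g = 2 * X - 1" using k1 by (simp_all add: f_def g_def)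
  show ?thesis
    using k1 q3 pp pne pD qB i j sets unfolding F by auto
qed

section \<open>Pell equations\<close>

locale pell_fundamental =
  fixes D x1 y1 :: int
  assumes D_pos: "D > 0" and x1: "x1 > 0" and y1: "y1 > 0"
    and fund: "x1\<^sup>2 = 1 + D * y1\<^sup>2"
    and minimal: "\<And>X Z. Z > 0 \<Longrightarrow> X\<^sup>2 = 1 + D * Z\<^sup>2 \<Longrightarrow> y1 \<le> Z"
begin

text \<open>\<open>px n + pz n * sqrt D\<close> is the \<open>n\<close>-th power of
  \<open>x1 + y1 * sqrt D\<close>.\<close>

fun px :: "nat \<Rightarrow> int" and pz :: "nat \<Rightarrow> int" where
  "px 0 = 1"
| "px (Suc n) = x1 * px n + D * y1 * pz n"
| "pz 0 = 0"
| "pz (Suc n) = x1 * pz n + y1 * px n"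

lemma px_pz_pos: "px n > 0 \<and> pz n \<ge> 0"
  using x1 y1 D_pos by (induction n) (auto intro: add_pos_nonneg)

lemma pell_norm: "(px n)\<^sup>2 = 1 + D * (pz n)\<^sup>2"
proof (induction n)
  case (Suc n)
  have "(px (Suc n))\<^sup>2 - D * (pz (Suc n))\<^sup>2 = (x1\<^sup>2 - D * y1\<^sup>2) * ((px n)\<^sup>2 - D * (pz n)\<^sup>2)"
    by (simp add: power2_eq_square algebra_simps)
  also have "\<dots> = 1" using Suc fund by simp
  finally show ?case by simp
qed simp

lemma pell_add:
  "px (m + n) = px m * px n + D * pz m * pz n"
  "pz (m + n) = px m * pz n + pz m * px n"
  by (induction m) (simp_all add: algebra_simps)

text \<open>Along the multiples of \<open>m\<close>, \<open>pz\<close> obeys a linear recurrence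
  with trace \<open>2 * px m\<close> and norm 1, which is the Chebyshev recurrence.\<close>

lemma pz_mult: "pz (j * m) = pz m * cheb_U (px m) j"
proof (induction "px m" j rule: cheb_U.induct)
  case (3 j)
  have "pz (j * m + m + m) = 2 * px m * pz (j * m + m) - ((px m)\<^sup>2 - D * (pz m)\<^sup>2) * pz (j * m)"
    unfolding pell_add by (simp add: power2_eq_square algebra_simps)
  also have "(px m)\<^sup>2 - D * (pz m)\<^sup>2 = 1" using pell_norm by simp
  finally have "pz (Suc (Suc j) * m) = 2 * px m * pz (Suc j * m) - pz (j * m)"
    by (simp add: add_ac)
  then show ?case using 3 by (simp add: algebra_simps)
qed simp_all

text \<open>Descent: multiplication by \<open>x1 - y1 * sqrt D\<close>, the inverse of the
  fundamental solution, gives a solution \<open>(X', Z')\<close> with smaller second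
  coordinate.\<close>

lemma pell_solution:
  assumes "X > 0" "Z \<ge> 0" "X\<^sup>2 = 1 + D * Z\<^sup>2"
  shows "\<exists>n. X = px n \<and> Z = pz n"
  using assms
proof (induction "nat Z" arbitrary: X Z rule: less_induct)
  case less
  show ?case
  proof (cases "Z = 0")
    case True
    then have "X = 1" using less.prems by (simp add: power2_eq_1_iff)
    then have "X = px 0 \<and> Z = pz 0" using True by simp
    then show ?thesis by blast
  next
    case False
    then have Z: "Z > 0" using less.prems by simp
    have le: "y1 \<le> Z" using minimal[OF Z less.prems(3)] .
    define X' where "X' = x1 * X - D * y1 * Z"
    define Z' where "Z' = x1 * Z - y1 * X"
    \<comment> \<open>Minimality enters here: after squaring, \<open>Z' \<ge> 0\<close> amounts to
      this inequality.\<close>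
    have sq: "y1\<^sup>2 \<le> Z\<^sup>2" using le y1 by (intro power_mono) auto
    have e1: "(x1 * X)\<^sup>2 = 1 + D * y1\<^sup>2 + D * Z\<^sup>2 + (D * y1 * Z)\<^sup>2"
      unfolding power_mult_distrib fund less.prems(3) by (simp add: power2_eq_square algebra_simps)
    have e2: "(x1 * Z)\<^sup>2 = Z\<^sup>2 + D * y1\<^sup>2 * Z\<^sup>2" "(y1 * X)\<^sup>2 = y1\<^sup>2 + D * y1\<^sup>2 * Z\<^sup>2"
      unfolding power_mult_distrib fund less.prems(3) by (simp_all add: power2_eq_square algebra_simps)
    have "D * y1\<^sup>2 \<ge> 0" "D * Z\<^sup>2 \<ge> 0" using D_pos by auto
    then have "(D * y1 * Z)\<^sup>2 < (x1 * X)\<^sup>2" unfolding e1 by linarith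
    then have "D * y1 * Z < x1 * X"
      by (rule power2_less_imp_less) (use x1 less.prems(1) in simp)
    then have X': "X' > 0" unfolding X'_def by simp
    have "(y1 * X)\<^sup>2 \<le> (x1 * Z)\<^sup>2" unfolding e2 using sq by simp
    then have "y1 * X \<le> x1 * Z"
      by (rule power2_le_imp_le) (use x1 Z in simp)
    then have Z': "Z' \<ge> 0" unfolding Z'_def by simp
    \<comment> \<open>The claim \<open>Z' < Z\<close>, in the form
      \<open>x1 * Z - Z < y1 * X\<close>, is also proved by comparing squares.\<close>
    have "(x1 * Z - Z)\<^sup>2 = (x1 * Z)\<^sup>2 - Z\<^sup>2 - 2 * (x1 - 1) * Z\<^sup>2"
      by (simp add: power2_eq_square algebra_simps)
    also have "\<dots> < (y1 * X)\<^sup>2"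
    proof -
      have "2 * (x1 - 1) * Z\<^sup>2 \<ge> 0" "y1\<^sup>2 > 0" using x1 y1 by auto
      then show ?thesis unfolding e2 by linarith
    qed
    finally have "x1 * Z - Z < y1 * X"
      by (rule power2_less_imp_less) (use y1 less.prems(1) in simp)
    then have lt: "nat Z' < nat Z" using Z by (simp add: Z'_def)
    have "X'\<^sup>2 - D * Z'\<^sup>2 = (x1\<^sup>2 - D * y1\<^sup>2) * (X\<^sup>2 - D * Z\<^sup>2)"
      unfolding X'_def Z'_def by (simp add: power2_eq_square algebra_simps)
    also have "\<dots> = 1" using fund less.prems by simp
    finally have "X'\<^sup>2 = 1 + D * Z'\<^sup>2" by simp
    from less.hyps[OF lt X' Z' this] obtain n where n: "X' = px n" "Z' = pz n" by blast
    have "px (Suc n) = (x1\<^sup>2 - D * y1\<^sup>2) * X" "pz (Suc n) = (x1\<^sup>2 - D * y1\<^sup>2) * Z"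
      unfolding px.simps pz.simps n[symmetric] X'_def Z'_def
      by (simp_all add: power2_eq_square algebra_simps)
    then have "px (Suc n) = X" "pz (Suc n) = Z" using fund by simp_all
    then show ?thesis by metis
  qed
qed

text \<open>\<open>pz (q * m)\<close> need only divide \<open>B\<close>, so that the prime factors
  of a proper divisor of the index can be treated with the same hypothesis on primes.\<close>

lemma prime_index_solution:
  assumes q: "prime (q :: nat)" and B: "pz (q * m) dvd B" "odd B"
    and primes: "\<And>r. prime r \<Longrightarrow> r dvd B \<Longrightarrow> r dvd D \<or> r = p"
  shows "q = 3 \<and> p \<noteq> 3 \<and> prime p \<and> \<not> p dvd D \<and> 3 dvd B \<and> (\<exists>i j. i > 0 \<and> j > 0 \<and>
    (2 * px m + 1 = 3 ^ j \<and> 2 * px m - 1 = p ^ i \<or> 2 * px m - 1 = 3 ^ j \<and> 2 * px m + 1 = p ^ i))"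
proof -
  have odd: "odd (pz (q * m))" using B by (meson dvd_trans)
  then have "odd (pz m)" "odd (cheb_U (px m) q)" unfolding pz_mult by auto
  \<comment> \<open>The Chebyshev value at index 2 is \<open>2 X\<close>, which is even.\<close>
  have "q \<noteq> 2"
    using \<open>odd (cheb_U (px m) q)\<close> by (auto simp: numeral_2_eq_2)
  then obtain k where k: "q = 2 * k + 1"
    using q by (metis oddE prime_odd_nat prime_ge_2_nat le_neq_implies_less)
  have "(pz m)\<^sup>2 > 0" using \<open>odd (pz m)\<close> by (auto simp: zero_less_power2)
  then have "(px m)\<^sup>2 > 1" unfolding pell_norm using D_pos by simp
  then have "px m \<noteq> 1" by auto
  then have "px m \<ge> 2" using px_pz_pos[of m] by linarith
  moreover have "D dvd (px m)\<^sup>2 - 1" unfolding pell_norm by simp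
  moreover have "prime (int q)" using q by simp
  moreover have "int q = 2 * int k + 1" using k by simp
  moreover have "cheb_U (px m) (2 * k + 1) dvd B"
    using B(1) unfolding pz_mult k by (metis dvd_mult_right)
  ultimately have "k = 1 \<and> p \<noteq> 3 \<and> prime p \<and> \<not> p dvd D \<and> 3 dvd B \<and> (\<exists>i j. i > 0 \<and> j > 0 \<and>
    (2 * px m + 1 = 3 ^ j \<and> 2 * px m - 1 = p ^ i \<or> 2 * px m - 1 = 3 ^ j \<and> 2 * px m + 1 = p ^ i))"
    using cheb_U_prime_index[OF _ _ _ _ _ B(2) primes] by blast
  then show ?thesis using k by simp
qed

lemma solution_index:
  assumes B: "odd (pz n)"
    and primes: "\<And>r. prime r \<Longrightarrow> r dvd pz n \<Longrightarrow> r dvd D \<or> r = p"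
  shows "n = 1 \<or> n = 3 \<and> p \<noteq> 3 \<and> prime p \<and> \<not> p dvd D \<and> 3 dvd pz n \<and> (\<exists>i j. i > 0 \<and> j > 0 \<and>
    (2 * x1 + 1 = 3 ^ j \<and> 2 * x1 - 1 = p ^ i \<or> 2 * x1 - 1 = 3 ^ j \<and> 2 * x1 + 1 = p ^ i))"
proof (cases "n = 1")
  case False
  then obtain q where q: "prime q" "q dvd n" using prime_factor_nat by blast
  then obtain m where m: "n = q * m" by blast
  have "pz (q * m) dvd pz n" using m by simp
  note step = prime_index_solution[OF q(1) this B primes]
  have "m = 1"
  proof (rule ccontr)
    \<comment> \<open>A second prime factor \<open>q'\<close> is also 3, and
      \<open>4 X^2 - 1\<close>, the value at index 3, shows that \<open>p\<close> divides
      \<open>pz m\<close>. But \<open>p\<close> also divides \<open>4 * (px m)^2 - 1\<close>, which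
      the Pell equation turns into 3 modulo \<open>pz m\<close>.\<close>
    assume "m \<noteq> 1"
    then obtain q' where q': "prime q'" "q' dvd m" using prime_factor_nat by blast
    then obtain m' where m': "m = q' * m'" by blast
    have "pz (q' * m') dvd pz n"
      unfolding m m'[symmetric] pz_mult[of q m] by simp
    note step' = prime_index_solution[OF q'(1) this B primes]
    from step' obtain i where i: "i > 0" "2 * px m' - 1 = p ^ i \<or> 2 * px m' + 1 = p ^ i" by blast
    then have "p dvd (2 * px m' - 1) * (2 * px m' + 1)" by (auto intro: dvd_mult dvd_mult2)
    also have "\<dots> = cheb_U (px m') q'"
      using step' by (simp add: numeral_3_eq_3 algebra_simps)
    also have "\<dots> dvd pz m" unfolding m' pz_mult by simp
    finally have pm: "p dvd pz m" .
    from step obtain i' where i': "i' > 0" "2 * px m - 1 = p ^ i' \<or> 2 * px m + 1 = p ^ i'" by blast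
    then have "p dvd (2 * px m - 1) * (2 * px m + 1)" by (auto intro: dvd_mult dvd_mult2)
    also have "\<dots> = 4 * (px m)\<^sup>2 - 1" by (simp add: power2_eq_square algebra_simps)
    also have "\<dots> = 4 * D * pz m * pz m + 3" unfolding pell_norm by (simp add: power2_eq_square)
    finally have "p dvd 3" using pm by (metis dvd_add_right_iff dvd_mult)
    then have "p = 3" using step primes_dvd_imp_eq[of p 3] by auto
    then show False using step by blast
  qed
  then have "px m = x1" by simp
  then show ?thesis using step m \<open>m = 1\<close> by auto
qed simp

end

section \<open>The equation in the variables \<open>N\<close>, \<open>B\<close> and
  \<open>y\<close>\<close>

lemma three_power_mod_4: "(3::int) ^ j mod 4 = (if even j then 1 else 3)"
proof (induction j)
  case (Suc j)
  have "(3::int) ^ Suc j mod 4 = 3 * (3 ^ j mod 4) mod 4" by (simp add: mod_mult_right_eq)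
  then show ?case unfolding Suc by simp
qed simp

text \<open>Read as a Pell equation for \<open>(x, B)\<close>, it has \<open>(c, y)\<close> as
  fundamental solution. Index 1 gives the first alternative, index 3 the second.\<close>

lemma stormer_type_equation:
  fixes N B x y e p :: int
  assumes e: "e = 1 \<or> e = -1" and N: "N \<ge> 3" "odd N" and y: "y > 0" "odd y"
    and B: "B > 0" "odd B" and x: "x > 0"
    and eq: "x\<^sup>2 = (N * B * y)\<^sup>2 - 2 * e * N * B\<^sup>2 + 1"
    and primes: "\<And>r. prime r \<Longrightarrow> r dvd B \<Longrightarrow> r dvd N \<or> r = p"
  defines "c \<equiv> N * y\<^sup>2 - e"
  shows "y = B \<and> x = N * B\<^sup>2 - e \<or>
    (\<exists>i j. i > 0 \<and> j > 0 \<and> prime p \<and> p \<noteq> 3 \<and> \<not> p dvd N \<and> \<not> p dvd y \<and>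
       B = y * 3 ^ j * p ^ i \<and> x = 4 * c ^ 3 - 3 * c \<and>
       (e = 1 \<and> odd j \<and> 3 ^ j = 2 * c - 1 \<and> p ^ i = 2 * c + 1 \<or>
        e = -1 \<and> even j \<and> 3 ^ j = 2 * c + 1 \<and> p ^ i = 2 * c - 1))"
proof -
  define D where "D = N * (N * y\<^sup>2 - 2 * e)"
  have "y\<^sup>2 \<ge> 1" using y by (simp add: int_one_le_iff_zero_less)
  then have "3 * 1 \<le> N * y\<^sup>2" using N by (intro mult_mono) auto
  then have Ny: "N * y\<^sup>2 \<ge> 3" by simp
  have cpos: "c > 0" using Ny e unfolding c_def by auto
  have ceven: "even c" using N y e unfolding c_def by auto
  have sandwich: "y \<le> Z" if Z: "Z > 0" and X: "X\<^sup>2 = 1 + D * Z\<^sup>2" for X Z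
  proof (rule ccontr)
    assume "\<not> y \<le> Z"
    then have lt: "Z < y" by simp
    \<comment> \<open>For \<open>Z < y\<close> the square of \<open>X\<close> would lie strictly
      between \<open>W^2\<close> and \<open>(W - e)^2\<close>, because
      \<open>0 < N * Z^2 < W\<close>.\<close>
    define W where "W = N * Z * y"
    have X': "\<bar>X\<bar>\<^sup>2 = W\<^sup>2 - 2 * e * (N * (Z * Z)) + 1"
      unfolding W_def power2_abs X D_def by (simp add: power2_eq_square algebra_simps)
    have NZ: "0 < N * (Z * Z)" using N Z by simp
    have ZW: "N * (Z * Z) < W" unfolding W_def using lt Z N by simp
    have W: "W > 0" using ZW NZ by simp
    from e show False
    proof
      assume "e = 1"
      then have "\<bar>X\<bar>\<^sup>2 < W\<^sup>2" using X' NZ by simp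
      then have "\<bar>X\<bar> < W" by (rule power2_less_imp_less) (use W in simp)
      moreover have "(W - 1)\<^sup>2 < \<bar>X\<bar>\<^sup>2"
        unfolding X' \<open>e = 1\<close> power2_diff using ZW by simp
      then have "W - 1 < \<bar>X\<bar>" by (rule power2_less_imp_less) simp
      ultimately show False by simp
    next
      assume "e = -1"
      then have "W\<^sup>2 < \<bar>X\<bar>\<^sup>2" using X' NZ by simp
      then have "W < \<bar>X\<bar>" by (rule power2_less_imp_less) simp
      moreover have "\<bar>X\<bar>\<^sup>2 < (W + 1)\<^sup>2"
        unfolding X' \<open>e = -1\<close> power2_sum using ZW by simp
      then have "\<bar>X\<bar> < W + 1" by (rule power2_less_imp_less) (use W in simp)
      ultimately show False by simp
    qed
  qed
  have e2: "e * e = 1" using e by auto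
  have fund: "c\<^sup>2 = 1 + D * y\<^sup>2"
    using e2 unfolding c_def D_def by (simp add: power2_eq_square algebra_simps)
  interpret pell_fundamental D c y
  proof
    show "D > 0" unfolding D_def using N Ny e by auto
  qed (use cpos y fund sandwich in auto)
  have "x\<^sup>2 = 1 + D * B\<^sup>2" unfolding eq D_def by (simp add: power2_eq_square algebra_simps)
  then obtain n where n: "x = px n" "B = pz n" using pell_solution x B by (meson less_imp_le)
  have prD: "r dvd D \<or> r = p" if "prime r" "r dvd pz n" for r
    using primes[of r] that unfolding n D_def by auto
  have "odd (pz n)" using B(2) n(2) by simp
  consider "n = 1" | i j where "n = 3" "p \<noteq> 3" "prime p" "\<not> p dvd D" "3 dvd B" "i > 0" "j > 0"
     "2 * c + 1 = 3 ^ j \<and> 2 * c - 1 = p ^ i \<or> 2 * c - 1 = 3 ^ j \<and> 2 * c + 1 = p ^ i"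
    using solution_index[OF \<open>odd (pz n)\<close> prD] n(2) by blast
  then show ?thesis
  proof cases
    case 1
    then have "x = c" "B = y" using n by simp_all
    then show ?thesis unfolding c_def by simp
  next
    case 2
    have "pz (3 * 1) = pz 1 * cheb_U (px 1) 3" by (rule pz_mult)
    then have "B = y * ((2 * c - 1) * (2 * c + 1))"
      using n 2(1) by (simp add: numeral_3_eq_3 algebra_simps)
    then have B': "B = y * 3 ^ j * p ^ i" using 2(8) by (metis mult.assoc mult.commute)
    have "px 3 = c ^ 3 + 3 * c * (D * y\<^sup>2)"
      by (simp add: numeral_3_eq_3 power2_eq_square algebra_simps)
    also have "D * y\<^sup>2 = c\<^sup>2 - 1" using fund by simp
    finally have x': "x = 4 * c ^ 3 - 3 * c"
      using n 2(1) by (simp add: power2_eq_square power3_eq_cube algebra_simps)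
    have pN: "\<not> p dvd N" using 2(4) unfolding D_def using dvd_mult2 by blast
    have "\<not> p dvd y"
    proof
      assume "p dvd y"
      have "p dvd (2 * c + 1) * (2 * c - 1)" using 2(6,8) by (auto intro: dvd_mult dvd_mult2)
      also have "\<dots> = 4 * c\<^sup>2 - 1" by (simp add: power2_eq_square algebra_simps)
      also have "\<dots> = 4 * D * y * y + 3" unfolding fund by (simp add: power2_eq_square)
      finally have "p dvd 3" using \<open>p dvd y\<close> by (metis dvd_add_right_iff dvd_mult)
      then show False using 2(2,3) primes_dvd_imp_eq[of p 3] by auto
    qed
    \<comment> \<open>Now \<open>c\<close> is \<open>-e\<close> modulo 3, so 3 cannot divide
      \<open>2 * c + e\<close>, and the power of 3 must be \<open>2 * c - e\<close>. As
      \<open>c\<close> is even, reduction modulo 4 gives the parity of \<open>j\<close>.\<close>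
    moreover have "3 dvd N" using primes[of 3] 2(2,5) by auto
    then have "3 dvd N * y\<^sup>2" by simp
    then obtain N' where N': "N * y\<^sup>2 = 3 * N'" by blast
    have three: "(3::int) dvd 3 ^ j" using 2(7) by simp
    obtain d where d: "c = 2 * d" using ceven by blast
    have mod4: "(4 * d + 1) mod 4 = 1" "(4 * d - 1) mod 4 = 3" by presburger+
    have "e = 1 \<and> odd j \<and> 3 ^ j = 2 * c - 1 \<and> p ^ i = 2 * c + 1 \<or>
        e = -1 \<and> even j \<and> 3 ^ j = 2 * c + 1 \<and> p ^ i = 2 * c - 1"
      using e
    proof
      assume e1: "e = 1"
      have "\<not> 3 dvd 2 * c + 1" unfolding c_def N' e1 by presburger
      then have s: "2 * c - 1 = 3 ^ j" "2 * c + 1 = p ^ i" using 2(8) three by metis+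
      then have "odd j" using three_power_mod_4[of j] mod4 unfolding d by (auto split: if_splits)
      then show ?thesis using s e1 by simp
    next
      assume e1: "e = -1"
      have "\<not> 3 dvd 2 * c - 1" unfolding c_def N' e1 by presburger
      then have s: "2 * c + 1 = 3 ^ j" "2 * c - 1 = p ^ i" using 2(8) three by metis+
      then have "even j" using three_power_mod_4[of j] mod4 unfolding d by (auto split: if_splits)
      then show ?thesis using s e1 by simp
    qed
    ultimately show ?thesis using 2 B' x' pN by blast
  qed
qed

section \<open>The families of solutions\<close>

text \<open>With \<open>T = P - e\<close> both sides become the square of
  \<open>T * (T^2 - 3) / 2\<close>, which is \<open>4 c^3 - 3 c\<close> at \<open>c = T / 2\<close>.
  Intended values: \<open>P = p^b\<close>, \<open>W = 3^m\<close>, \<open>S = M R y\<close>.\<close>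

lemma exceptional_family_identity:
  fixes e P W S x :: real
  assumes "e\<^sup>2 = 1" "P = W + 2 * e" "2 * S = (P + e) * W" "x = 1 / 2 * (P - e) * ((P - e)\<^sup>2 - 3)"
  shows "x\<^sup>2 = (P * S)\<^sup>2 - 2 * e * P\<^sup>2 * (S * W) + 1"
proof -
  define T where "T = P - e"
  have PW: "P = T + e" "W = T - e" using assms(2) by (simp_all add: T_def)
  have S: "S = (T + 2 * e) * W / 2" using assms(3) PW by (simp add: add_ac)
  have ee: "e * e = 1" using assms(1) by (simp add: power2_eq_square)
  have "(P * S)\<^sup>2 - 2 * e * P\<^sup>2 * (S * W) = (P * W)\<^sup>2 * ((T + 2 * e) * (T - 2 * e)) / 4"
    unfolding S by (simp add: power2_eq_square field_simps)
  also have "P * W = T\<^sup>2 - 1" unfolding PW using ee by (simp add: power2_eq_square algebra_simps)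
  also have "(T + 2 * e) * (T - 2 * e) = T\<^sup>2 - 4" using ee by (simp add: power2_eq_square algebra_simps)
  finally have "(P * S)\<^sup>2 - 2 * e * P\<^sup>2 * (S * W) + 1 = (1 / 2 * T * (T\<^sup>2 - 3))\<^sup>2"
    by (simp add: power2_eq_square field_simps)
  then show ?thesis by (simp only: assms(4) T_def)
qed

lemma three_powi_minus:
  "(3::real) powi (- int m) = 1 / 3 ^ m" "(3::real) powi (- 2 * int m) = 1 / (3 ^ m)\<^sup>2"
proof -
  show "(3::real) powi (- int m) = 1 / 3 ^ m"
    by (simp add: power_int_minus divide_inverse)
  have "- 2 * int m = - int (m * 2)" by simp
  then show "(3::real) powi (- 2 * int m) = 1 / (3 ^ m)\<^sup>2"
    by (simp only: power_int_minus power_int_of_nat power_mult divide_inverse mult_1_left)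
qed

theorem theorem4p13:
  fixes p s x y a b :: nat and k t r :: "nat \<Rightarrow> nat" and \<delta> :: int
  assumes "prime p" and "odd p" and "s \<ge> 1"
    and "\<forall>i\<in>{1..s}. odd (k i) \<and> k i > 1"
    and "admissible s x y a b t r"
  shows "(\<delta> \<in> {2, -2} \<longrightarrow>
            (equation p s k \<delta> x y a b t r \<longleftrightarrow>
               family_A p s k \<delta> x y a b t r \<or>
               family_B p s k \<delta> x y a b t r \<or>
               family_C p s k \<delta> x y a b t r)) \<and>
         (\<delta> \<in> {4, -4} \<longrightarrow> \<not> equation p s k \<delta> x y a b t r)"
proof -
  have adm: "x > 0" "y > 0" "a > 0" "b > 0" "odd y" "a \<ge> b" "\<And>i. i \<in> {1..s} \<Longrightarrow> r i < t i"
    using assms(5) unfolding admissible_def by auto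
  have k: "odd (k i)" "k i > 1" if "i \<in> {1..s}" for i using assms(4) that by auto
  define M where "M = (\<Prod>i=1..s. k i ^ (t i - r i))"
  define R where "R = (\<Prod>i=1..s. k i ^ r i)"
  define N where "N = p ^ (a - b) * M"
  define B where "B = p ^ b * R"
  \<comment> \<open>Since \<open>r i < t i\<close>, no subtraction is truncated:
    \<open>2 t = 2 (t - r) + 2 r\<close> and \<open>t + r = (t - r) + 2 r\<close>.\<close>
  have prod_t: "(\<Prod>i=1..s. k i ^ (2 * t i)) = (M * R)\<^sup>2"
    unfolding M_def R_def prod.distrib[symmetric] prod_power_distrib
    by (rule prod.cong) (use adm(7) in \<open>auto simp: power_add[symmetric] power_mult[symmetric] mult.commute less_imp_le\<close>)
  have prod_tr: "(\<Prod>i=1..s. k i ^ (t i + r i)) = M * R\<^sup>2"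
    unfolding M_def R_def prod.distrib[symmetric] prod_power_distrib
    by (rule prod.cong) (use adm(7) in \<open>auto simp: power_add[symmetric] power_mult[symmetric] less_imp_le mult_2_right\<close>)
  have pa: "p ^ a = p ^ (a - b) * p ^ b" using adm(6) by (simp add: power_add[symmetric])
  have t1: "p ^ (2 * a) * (M * R)\<^sup>2 * y\<^sup>2 = (N * B * y)\<^sup>2"
    unfolding N_def B_def by (simp only: power_even_eq pa) (simp add: power_mult_distrib mult_ac)
  have t2: "p ^ (a + b) * (M * R\<^sup>2) = N * B\<^sup>2"
    unfolding N_def B_def by (simp add: power_add pa power2_eq_square mult_ac)
  have eq_iff: "equation p s k \<delta> x y a b t r \<longleftrightarrow>
      (int x)\<^sup>2 = (int N * int B * int y)\<^sup>2 - int N * (int B)\<^sup>2 * \<delta> + 1"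
    unfolding equation_def prod_t prod_tr t1 t2 by simp
  have prod_tr_real: "(\<Prod>i=1..s. real (k i) ^ (t i + r i)) = real M * (real R)\<^sup>2"
    using arg_cong[OF prod_tr, of real] by simp
  have prod_r_real: "(\<Prod>i=1..s. real (k i) ^ r i) = real R"
    unfolding R_def by simp
  have "odd M" "odd R" using k unfolding M_def R_def by (auto simp: even_prod_iff)
  then have odd: "odd M" "odd R" "odd B" "odd N" using assms(2) unfolding N_def B_def by auto
  note pos = odd_pos[OF assms(2)] odd[THEN odd_pos] odd
  \<comment> \<open>The factor of index 1 already exceeds 1; oddness then raises the bound to
    3.\<close>
  have "M > 1"
  proof -
    have "k 1 ^ (t 1 - r 1) dvd M" unfolding M_def using assms(3) by (intro dvd_prodI) auto
    moreover have "k 1 ^ (t 1 - r 1) > 1" using k(2)[of 1] adm(7)[of 1] assms(3) by (intro one_less_power) auto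
    ultimately show ?thesis using odd_pos[OF odd(1)] by (meson dvd_imp_le less_le_trans)
  qed
  have "M \<noteq> 2" using pos by auto
  with \<open>M > 1\<close> have "M \<ge> 3" by linarith
  moreover have "M \<le> N" unfolding N_def using pos by simp
  ultimately have N3: "N \<ge> 3" by simp
  \<comment> \<open>The exponents \<open>t i - r i\<close> are positive, so every base
    \<open>k i\<close> divides \<open>M\<close>.\<close>
  have R_imp_M: "q dvd M" if q: "prime q" "q dvd R" for q
  proof -
    obtain i where i: "i \<in> {1..s}" "q dvd k i ^ r i"
      using q prime_dvd_prod_iff[of "{1..s}" q] unfolding R_def by auto
    then have "q dvd k i" using q(1) prime_dvd_power by blast
    then have "q dvd k i ^ (t i - r i)" using adm(7)[OF i(1)] by (intro dvd_power_le[of _ _ 1, simplified]) auto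
    also have "\<dots> dvd M" unfolding M_def using i by (intro dvd_prodI) auto
    finally show ?thesis .
  qed
  have primes_nat: "q dvd N \<or> q = p" if q: "prime q" "q dvd B" for q
  proof -
    have "q dvd p ^ b \<or> q dvd R" using q prime_dvd_mult_iff unfolding B_def by blast
    then show ?thesis
    proof
      assume "q dvd p ^ b"
      then show ?thesis using q(1) assms(1) prime_dvd_power primes_dvd_imp_eq by blast
    next
      assume "q dvd R"
      then show ?thesis using R_imp_M[OF q(1)] unfolding N_def by simp
    qed
  qed
  have primes: "q dvd int N \<or> q = int p" if q: "prime q" "q dvd int B" for q
  proof -
    obtain q' where q': "q = int q'" using prime_gt_0_int[OF q(1)] by (metis zero_less_imp_eq_int)
    then show ?thesis using primes_nat[of q'] q by auto
  qed
  have main: "equation p s k \<delta> x y a b t r \<longleftrightarrow>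
       family_A p s k \<delta> x y a b t r \<or> family_B p s k \<delta> x y a b t r \<or> family_C p s k \<delta> x y a b t r"
    if \<delta>: "\<delta> \<in> {2, -2}"
  proof -
    obtain e :: int where e: "\<delta> = 2 * e" "e = 1 \<or> e = -1" using \<delta> by auto
    have A_iff: "family_A p s k \<delta> x y a b t r \<longleftrightarrow> y = B \<and> int x = int N * (int B)\<^sup>2 - e"
    proof -
      have "real p ^ (a + b) * (real M * (real R)\<^sup>2) = real N * (real B)\<^sup>2"
        using arg_cong[OF t2, of real] by simp
      then have "family_A p s k \<delta> x y a b t r \<longleftrightarrow> p dvd y \<and> 
          real_of_int (int x) = real_of_int (int N * (int B)\<^sup>2 - e) \<and> y = B"
        unfolding family_A_def prod_tr_real R_def[symmetric] B_def[symmetric] e(1) by simp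
      then show ?thesis unfolding of_int_eq_iff using adm(4) by (auto simp: B_def)
    qed
    show ?thesis
    proof
      assume "equation p s k \<delta> x y a b t r"
      then have eq: "(int x)\<^sup>2 = (int N * int B * int y)\<^sup>2 - 2 * e * int N * (int B)\<^sup>2 + 1"
        unfolding eq_iff unfolding e(1) by (simp add: mult_ac)
      define c where "c = int N * (int y)\<^sup>2 - e"
      from stormer_type_equation[OF e(2) _ _ _ _ _ _ _ eq primes] N3 pos adm
      consider "y = B" "int x = int N * (int B)\<^sup>2 - e"
        | i j where "i > 0" "j > 0" "p \<noteq> 3" "\<not> p dvd N" "\<not> p dvd y"
           "int B = int y * 3 ^ j * int p ^ i" "int x = 4 * c ^ 3 - 3 * c"
           "e = 1 \<and> odd j \<and> 3 ^ j = 2 * c - 1 \<and> int p ^ i = 2 * c + 1 \<or>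
            e = -1 \<and> even j \<and> 3 ^ j = 2 * c + 1 \<and> int p ^ i = 2 * c - 1"
        unfolding c_def by (force simp: int_dvd_int_iff)
      then show "family_A p s k \<delta> x y a b t r \<or> family_B p s k \<delta> x y a b t r \<or> family_C p s k \<delta> x y a b t r"
      proof cases
        case 1
        then show ?thesis using A_iff by simp
      next
        case 2
        have ab: "a = b" using 2(4) adm(6) unfolding N_def
          by (cases "a - b") auto
        have pM: "\<not> p dvd M" and NM: "N = M" using 2(4) unfolding N_def ab by auto
        then have pR: "\<not> p dvd R" using R_imp_M assms(1) by blast
        have "int B = int (y * 3 ^ j * p ^ i)" using 2(6) by simp
        \<comment> \<open>Comparing the exponents of \<open>p\<close> on both sides gives
          \<open>b = i\<close>, and then \<open>R = 3 ^ j * y\<close>.\<close>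
        then have "p ^ b * R = p ^ i * (3 ^ j * y)" unfolding of_nat_eq_iff B_def by (simp add: mult_ac)
        moreover have p3: "\<not> p dvd 3 ^ j * y"
          using 2(3,5) assms(1) prime_dvd_power[OF assms(1), of 3 j] primes_dvd_imp_eq[OF assms(1), of 3]
          by (auto simp: prime_dvd_mult_iff)
        ultimately have "multiplicity p (p ^ b * R) = multiplicity p (p ^ i * (3 ^ j * y))" by simp
        then have bi: "b = i" using pR p3 assms(1) odd_pos[OF odd(2)] adm(2)
          by (simp add: prime_elem_multiplicity_mult_distrib not_dvd_imp_multiplicity_0)
        with pR p3 have Ry: "R = 3 ^ j * y"
          using \<open>p ^ b * R = p ^ i * (3 ^ j * y)\<close> pos(1) by simp
        define C where "C = real N * (real y)\<^sup>2 - of_int e"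
        have C: "of_int c = C" unfolding c_def C_def by simp
        have x': "real x = 4 * C ^ 3 - 3 * C"
          using arg_cong[OF 2(7), of real_of_int] by (simp add: C)
        have R': "real R = 3 ^ j * real y" using Ry by simp
        from 2(8) show ?thesis
        proof
          assume *: "e = 1 \<and> odd j \<and> 3 ^ j = 2 * c - 1 \<and> int p ^ i = 2 * c + 1"
          have P: "real p ^ b = 2 * C + 1" and W: "3 ^ j = 2 * C - 1"
          proof -
            have "real_of_int (int p ^ i) = of_int (2 * c + 1)" "real_of_int (3 ^ j) = of_int (2 * c - 1)"
              using * by metis+
            then show "real p ^ b = 2 * C + 1" "3 ^ j = 2 * C - 1" by (simp_all add: C bi)
          qed
          have "family_B p s k \<delta> x y a b t r"
            unfolding family_B_def prod_tr_real prod_r_real three_powi_minus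
          proof (intro conjI exI[of _ j])
            show "real p ^ b = 2 * (1 / (3 ^ j)\<^sup>2) * (real M * (real R)\<^sup>2) - 1"
              using * NM unfolding P C_def R' by (simp add: power_mult_distrib)
            show "real x = 1 / 2 * (real p ^ b - 1) * ((real p ^ b - 1)\<^sup>2 - 3)"
              unfolding P x' by (simp add: power2_eq_square power3_eq_cube algebra_simps)
          qed (use * 2(2) ab P W R' e(1) in auto)
          then show ?thesis by simp
        next
          assume *: "e = -1 \<and> even j \<and> 3 ^ j = 2 * c + 1 \<and> int p ^ i = 2 * c - 1"
          have P: "real p ^ b = 2 * C - 1" and W: "3 ^ j = 2 * C + 1"
          proof -
            have "real_of_int (int p ^ i) = of_int (2 * c - 1)" "real_of_int (3 ^ j) = of_int (2 * c + 1)"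
              using * by metis+
            then show "real p ^ b = 2 * C - 1" "3 ^ j = 2 * C + 1" by (simp_all add: C bi)
          qed
          have "family_C p s k \<delta> x y a b t r"
            unfolding family_C_def prod_tr_real prod_r_real three_powi_minus
          proof (intro conjI exI[of _ j])
            show "real p ^ b = 2 * (1 / (3 ^ j)\<^sup>2) * (real M * (real R)\<^sup>2) + 1"
              using * NM unfolding P C_def R' by (simp add: power_mult_distrib)
            show "real x = 1 / 2 * (real p ^ b + 1) * ((real p ^ b + 1)\<^sup>2 - 3)"
              unfolding P x' by (simp add: power2_eq_square power3_eq_cube algebra_simps)
          qed (use * 2(2) ab P W R' e(1) in auto)
          then show ?thesis by simp
        qed
      qed
    next
      assume families: "family_A p s k \<delta> x y a b t r \<or> family_B p s k \<delta> x y a b t r \<or> family_C p s k \<delta> x y a b t r"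
      \<comment> \<open>Families B and C are verified together, the sign \<open>e\<close>
        distinguishing them.\<close>
      have "equation p s k \<delta> x y a b t r"
        if ab: "a = b" and W: "real p ^ b = 3 ^ m + 2 * real_of_int e"
          and P: "real p ^ b = 2 * (1 / (3 ^ m)\<^sup>2) * (real M * (real R)\<^sup>2) - e"
          and x: "real x = 1 / 2 * (real p ^ b - e) * ((real p ^ b - e)\<^sup>2 - 3)"
          and y: "real y = 1 / 3 ^ m * real R" for m
      proof -
        define S where "S = real M * real R * real y"
        have R: "real R = 3 ^ m * real y" using y by simp
        have SW: "S * 3 ^ m = real M * (real R)\<^sup>2"
          unfolding S_def using R by (simp add: power2_eq_square)
        \<comment> \<open>By \<open>SW\<close>, the second formula for \<open>p ^ b\<close> reads
          \<open>2 * S / 3 ^ m - e\<close>.\<close>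
        have "2 * S = (real p ^ b + e) * 3 ^ m"
          unfolding P SW[symmetric] by (simp add: power2_eq_square)
        then have "(real x)\<^sup>2 = (real p ^ b * S)\<^sup>2 - 2 * real_of_int e * (real p ^ b)\<^sup>2 * (S * 3 ^ m) + 1"
          by (intro exceptional_family_identity[OF _ W _ x]) (use e(2) in auto)
        also have "\<dots> = (real N * real B * real y)\<^sup>2 - real N * (real B)\<^sup>2 * \<delta> + 1"
          unfolding SW unfolding S_def N_def B_def ab e(1) by (simp add: power_mult_distrib mult_ac)
        finally have "real_of_int ((int x)\<^sup>2) = real_of_int ((int N * int B * int y)\<^sup>2 - int N * (int B)\<^sup>2 * \<delta> + 1)"
          by simp
        then show "equation p s k \<delta> x y a b t r" unfolding eq_iff of_int_eq_iff .
      qed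
      note exceptional = this
      consider (A) "family_A p s k \<delta> x y a b t r" | (B) "family_B p s k \<delta> x y a b t r"
        | (C) "family_C p s k \<delta> x y a b t r" using families by blast
      then show "equation p s k \<delta> x y a b t r"
      proof cases
        case A
        then have yx: "y = B" "int x = int N * (int B)\<^sup>2 - e" unfolding A_iff by auto
        have "e\<^sup>2 = 1" using e(2) by auto
        then show ?thesis
          unfolding eq_iff unfolding e(1) yx by (simp add: power2_diff power2_eq_square algebra_simps)
      next
        case B
        then have e1: "e = 1" using e unfolding family_B_def by auto
        from B obtain m where m: "real p ^ b = 3 ^ m + 2"
          "real p ^ b = 2 * (1 / (3 ^ m)\<^sup>2) * (real M * (real R)\<^sup>2) - 1"
          "real x = 1 / 2 * (real p ^ b - 1) * ((real p ^ b - 1)\<^sup>2 - 3)"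
          "real y = 1 / 3 ^ m * real R" "a = b"
          unfolding family_B_def prod_tr_real prod_r_real three_powi_minus by blast
        show ?thesis
          by (rule exceptional[of m]) (unfold e1, use m in simp_all)
      next
        case C
        then have e1: "e = -1" using e unfolding family_C_def by auto
        from C obtain m where m: "real p ^ b = 3 ^ m - 2"
          "real p ^ b = 2 * (1 / (3 ^ m)\<^sup>2) * (real M * (real R)\<^sup>2) + 1"
          "real x = 1 / 2 * (real p ^ b + 1) * ((real p ^ b + 1)\<^sup>2 - 3)"
          "real y = 1 / 3 ^ m * real R" "a = b"
          unfolding family_C_def prod_tr_real prod_r_real three_powi_minus by blast
        show ?thesis
          by (rule exceptional[of m]) (unfold e1, use m in simp_all)
      qed
    qed
  qed
  have "\<not> equation p s k \<delta> x y a b t r" if \<delta>: "\<delta> \<in> {4, -4}"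
  proof
    assume "equation p s k \<delta> x y a b t r"
    then have eq: "(int x)\<^sup>2 = (int N * int B * int y)\<^sup>2 - int N * (int B)\<^sup>2 * \<delta> + 1"
      unfolding eq_iff .
    have "odd (int N * int B * int y)" using pos adm by simp
    then obtain u where u: "int N * int B * int y = 2 * u + 1" by (rule oddE)
    obtain v where v: "\<delta> = 4 * v" using \<delta> by auto
    have sq: "(int x)\<^sup>2 = 4 * (u * u + u - int N * (int B)\<^sup>2 * v) + 2"
      unfolding eq u v by (simp add: power2_eq_square algebra_simps)
    then have "even ((int x)\<^sup>2)" by simp
    then obtain w where "int x = 2 * w" by (auto elim: evenE)
    then have "4 * w\<^sup>2 = 4 * (u * u + u - int N * (int B)\<^sup>2 * v) + 2"
      using sq by (simp add: power_mult_distrib)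
    then show False by presburger
  qed
  with main show ?thesis by blast
qed

end
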